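(* Suppose that $\sum_{n=0}^\infty a_n^{-1}<\infty$, that $\beta_n\to\beta_\infty$ as $n\to\infty$ with $|\beta_\infty|<1$, that $\sum_n |k_n-1|<\infty$, and that $\sum_n|\beta_{n+1}-\beta_n|<\infty$. Then, for all $z\in\mathbb C$, the sequence of the orthogonal polynomials $P_n(z)$ has the asymptotics $$P_n(z)=a_n^{-1/2}\Big(\kappa(z)e^{-i\phi_n+i\eta(z)}+\kappa(\bar z)e^{i\phi_n-i\eta(\bar z)}+O(\varepsilon_n)\Big),\qquad n\to\infty .$$ This asymptotics is uniform in $z$ from compact subsets of $\mathbb C$.
   Context: $\mathbb Z_+=\{0,1,2,\dots\}$. The coefficients satisfy $a_n>0$, $b_n\in\mathbb R$ for $n\in\mathbb Z_+$, and by convention $a_{-1}=1/2$. Notation: $$\beta_n=-\frac{b_n}{2\sqrt{a_{n-1}a_n}},\qquad \alpha_n=\frac1{2\sqrt{a_{n-1}a_n}},\qquad k_n=\frac{a_n}{\sqrt{a_{n-1}a_{n+1}}}.$$ The phase is $\phi_n=\sum_{m}\arccos\beta_m$, the sum being over those $m\in\{0,\dots,n-1\}$ with $|\beta_m|\le1$ ($\arccos$ takes values in $[0,\pi]$). The remainder is $$\varepsilon_n=\sum_{m=n+1}^\infty\big(|\beta_{m-1}-\beta_m|+|k_m-1|+\alpha_m|z|\big).$$ The Jacobi equation is $a_{n-1}F_{n-1}+b_nF_n+a_nF_{n+1}=zF_n$, $n\in\mathbb Z_+$, for sequences $(F_n)_{n\ge-1}$. The orthogonal polynomials $P_n(z)$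 are its solution with $P_{-1}(z)=0$, $P_0(z)=1$. The Jost solution $f_n(z)$ is its unique solution with $f_n(z)=a_n^{-1/2}e^{-i\phi_n}(1+o(1))$ as $n\to\infty$, and $\tilde f_n(z)=\overline{f_n(\bar z)}$ is the conjugate Jost solution; $f(z)$ and $\tilde f(z)$ are linearly independent solutions. Let $k_\pm(z)$ be the coefficients (not to be confused with $k_n$) in $P_n(z)=k_+(z)f_n(z)+k_-(z)\tilde f_n(z)$; one has $k_-(z)=\overline{k_+(\bar z)}$. Set $\kappa(z)=|k_+(z)|$ and define $\eta(z)\in\mathbb R/2\pi\mathbb Z$ by $k_+(z)=\kappa(z)e^{i\eta(z)}$ (arbitrary if $\kappa(z)=0$). *)

theory Defs
  imports Complex_Main "HOL-Library.Landau_Symbols"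
begin

text \<open>
  Jacobi coefficients are sequences \<open>a b :: nat \<Rightarrow> real\<close>. \<open>aprev a n\<close> is the
  coefficient of index \<open>n - 1\<close>, with the value \<open>1/2\<close> at index \<open>-1\<close>.
\<close>

definition aprev :: "(nat \<Rightarrow> real) \<Rightarrow> nat \<Rightarrow> real" where
  "aprev a n = (if n = 0 then 1 / 2 else a (n - 1))"

definition jbeta :: "(nat \<Rightarrow> real) \<Rightarrow> (nat \<Rightarrow> real) \<Rightarrow> nat \<Rightarrow> real" where
  "jbeta a b n = - b n / (2 * sqrt (aprev a n * a n))"

definition jalpha :: "(nat \<Rightarrow> real) \<Rightarrow> nat \<Rightarrow> real" where
  "jalpha a n = 1 / (2 * sqrt (aprev a n * a n))"

definition jk :: "(nat \<Rightarrow> real) \<Rightarrow> nat \<Rightarrow> real" where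
  "jk a n = a n / sqrt (aprev a n * a (n + 1))"

definition phase :: "(nat \<Rightarrow> real) \<Rightarrow> (nat \<Rightarrow> real) \<Rightarrow> nat \<Rightarrow> real" where
  "phase a b n = (\<Sum>m | m < n \<and> \<bar>jbeta a b m\<bar> \<le> 1. arccos (jbeta a b m))"

text \<open>The series over \<open>m \<ge> n + 1\<close> is written with \<open>m = j + n + 1\<close>.\<close>

definition remainder :: "(nat \<Rightarrow> real) \<Rightarrow> (nat \<Rightarrow> real) \<Rightarrow> nat \<Rightarrow> complex \<Rightarrow> real" where
  "remainder a b n z =
     (\<Sum>j. let m = j + n + 1 in
        \<bar>jbeta a b (m - 1) - jbeta a b m\<bar> + \<bar>jk a m - 1\<bar> + jalpha a m * cmod z)"

text \<open>
  A sequence indexed by the integers \<open>n \<ge> -1\<close> is represented by a function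
  \<open>F :: nat \<Rightarrow> complex\<close> with the index shifted by one: \<open>F 0\<close> is the term of index
  \<open>-1\<close>, and \<open>F (n + 1)\<close> is the term of index \<open>n\<close>.
\<close>

definition jacobi_solution ::
    "(nat \<Rightarrow> real) \<Rightarrow> (nat \<Rightarrow> real) \<Rightarrow> complex \<Rightarrow> (nat \<Rightarrow> complex) \<Rightarrow> bool" where
  "jacobi_solution a b z F \<longleftrightarrow>
     (\<forall>n. of_real (aprev a n) * F n + of_real (b n) * F (n + 1) + of_real (a n) * F (n + 2)
          = z * F (n + 1))"

definition orth_solution ::
    "(nat \<Rightarrow> real) \<Rightarrow> (nat \<Rightarrow> real) \<Rightarrow> complex \<Rightarrow> nat \<Rightarrow> complex" where
  "orth_solution a b z = (THE F. jacobi_solution a b z F \<and> F 0 = 0 \<and> F 1 = 1)"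

definition jost_solution ::
    "(nat \<Rightarrow> real) \<Rightarrow> (nat \<Rightarrow> real) \<Rightarrow> complex \<Rightarrow> nat \<Rightarrow> complex" where
  "jost_solution a b z =
     (THE F. jacobi_solution a b z F \<and>
        (\<lambda>n. F (n + 1)) \<sim>[sequentially]
          (\<lambda>n. of_real (a n powr (- 1 / 2)) * exp (- \<i> * of_real (phase a b n))))"

definition jost_conj ::
    "(nat \<Rightarrow> real) \<Rightarrow> (nat \<Rightarrow> real) \<Rightarrow> complex \<Rightarrow> nat \<Rightarrow> complex" where
  "jost_conj a b z n = cnj (jost_solution a b (cnj z) n)"

text \<open>The pair of connection coefficients, of the Jost solution and of its conjugate.\<close>

definition jost_coeffs ::
    "(nat \<Rightarrow> real) \<Rightarrow> (nat \<Rightarrow> real) \<Rightarrow> complex \<Rightarrow> complex \<times> complex" where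
  "jost_coeffs a b z =
     (THE k. \<forall>n. orth_solution a b z n
                  = fst k * jost_solution a b z n + snd k * jost_conj a b z n)"

definition k_plus :: "(nat \<Rightarrow> real) \<Rightarrow> (nat \<Rightarrow> real) \<Rightarrow> complex \<Rightarrow> complex" where
  "k_plus a b z = fst (jost_coeffs a b z)"

definition kappa :: "(nat \<Rightarrow> real) \<Rightarrow> (nat \<Rightarrow> real) \<Rightarrow> complex \<Rightarrow> real" where
  "kappa a b z = cmod (k_plus a b z)"

text \<open>The orthogonal polynomial of degree \<open>n\<close>, with the unshifted index.\<close>

definition orth_poly ::
    "(nat \<Rightarrow> real) \<Rightarrow> (nat \<Rightarrow> real) \<Rightarrow> nat \<Rightarrow> complex \<Rightarrow> complex" where
  "orth_poly a b n z = orth_solution a b z (n + 1)"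

end

theory Submission imports Defs "HOL-Analysis.Elementary_Normed_Spaces" begin

text \<open>
  Write a solution as \<open>F\<^sub>n = a\<^sub>n\<^sup>-\<^sup>1\<^sup>/\<^sup>2 u\<^sub>n\<close> and vary constants in
  \<open>u\<^sub>n = p\<^sub>n e\<^sup>-\<^sup>i\<^sup>\<phi> + q\<^sub>n e\<^sup>i\<^sup>\<phi>\<close> with \<open>\<phi> = \<phi>\<^sub>n\<close>, requiring the same
  amplitudes to represent \<open>u\<close> at \<open>n\<close> and at \<open>n + 1\<close>. Where \<open>\<beta>\<close> stays
  away from \<open>\<plusminus>1\<close>, the recurrence changes the amplitude vector from \<open>n - 1\<close> to \<open>n\<close> by at
  most a constant multiple of the \<open>n\<close>-th term of the series for the remainder, relative to its size.
  So the amplitudes converge, with error \<open>O(\<epsilon>\<^sub>n)\<close>, and a solution whose limit amplitudes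
  vanish is zero. The map from solutions to limit amplitudes is therefore a linear bijection onto
  \<open>\<complex>\<^sup>2\<close>; the Jost solution and its conjugate correspond to \<open>(1, 0)\<close> and \<open>(0, 1)\<close>, and
  the limit amplitudes of the orthogonal polynomials are the coefficients \<open>k\<^sub>+\<close> and \<open>k\<^sub>-\<close>.
\<close>

section \<open>Sequences with summable relative increments\<close>

text \<open>A discrete Gronwall argument. Since \<open>1 + d n \<le> exp (d n)\<close>, the sequence
  stays bounded, so its increments are absolutely summable, and \<open>L - v n\<close> is the tail
  of their series.\<close>

lemma limit_of_small_relative_steps:
  fixes v :: "nat \<Rightarrow> 'a::banach"
  assumes sd: "summable d" and d0: "\<And>n. 0 \<le> d n"
    and step: "\<And>n. norm (v (Suc n) - v n) \<le> d n * norm (v n)"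
  obtains L where "v \<longlonglongrightarrow> L"
    "\<And>n. norm (L - v n) \<le> exp (suminf d) * norm (v 0) * (\<Sum>j. d (j + n))"
proof -
  define M where "M = exp (suminf d) * norm (v 0)"
  have 1: "norm (v n) \<le> exp (\<Sum>j<n. d j) * norm (v 0)" for n
  proof (induction n)
    case (Suc n)
    have "norm (v (Suc n)) \<le> norm (v (Suc n) - v n) + norm (v n)"
      by (metis diff_add_cancel norm_triangle_ineq)
    also have "\<dots> \<le> (1 + d n) * norm (v n)"
      using step[of n] by (simp add: algebra_simps)
    also have "\<dots> \<le> exp (d n) * norm (v n)"
      by (intro mult_right_mono) auto
    also have "\<dots> \<le> exp (d n) * (exp (\<Sum>j<n. d j) * norm (v 0))"
      by (intro mult_left_mono Suc) auto
    finally show ?case by (simp add: exp_add mult_ac)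
  qed simp
  have 2: "norm (v n) \<le> M" for n
  proof -
    have "exp (\<Sum>j<n. d j) * norm (v 0) \<le> M"
      unfolding M_def using sum_le_suminf[OF sd, of "{..<n}"] d0
      by (intro mult_right_mono) auto
    with 1[of n] show ?thesis by linarith
  qed
  have 3: "norm (v (Suc n) - v n) \<le> M * d n" for n
    using step[of n] mult_left_mono[OF 2[of n] d0[of n]] by (simp add: mult.commute)
  have "summable (\<lambda>n. v (Suc n) - v n)"
    using 3 by (intro summable_comparison_test'[OF summable_mult[OF sd, of M], of 0]) auto
  then have "(\<lambda>n. \<Sum>j<n. v (Suc j) - v j) \<longlonglongrightarrow> (\<Sum>n. v (Suc n) - v n)"
    by (rule summable_LIMSEQ)
  then have "(\<lambda>n. v n - v 0) \<longlonglongrightarrow> (\<Sum>n. v (Suc n) - v n)"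
    by (simp add: sum_lessThan_telescope)
  then have "(\<lambda>n. (v n - v 0) + v 0) \<longlonglongrightarrow> (\<Sum>n. v (Suc n) - v n) + v 0"
    by (intro tendsto_intros)
  then obtain L where L: "v \<longlonglongrightarrow> L" by auto
  have "norm (L - v n) \<le> M * (\<Sum>j. d (j + n))" for n
  proof -
    have "(\<lambda>j. v (j + n)) \<longlonglongrightarrow> L" using L by (rule LIMSEQ_ignore_initial_segment)
    from telescope_sums[OF this] have s: "(\<lambda>j. v (Suc (j + n)) - v (j + n)) sums (L - v n)"
      by simp
    have sd': "summable (\<lambda>j. M * d (j + n))"
      using sd by (intro summable_mult) (simp add: summable_iff_shift)
    have sn: "summable (\<lambda>j. norm (v (Suc (j + n)) - v (j + n)))"
      using 3 by (intro summable_comparison_test'[OF sd', of 0]) auto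
    have "norm (L - v n) \<le> (\<Sum>j. norm (v (Suc (j + n)) - v (j + n)))"
      using summable_norm[OF sn] s by (simp add: sums_iff)
    also have "\<dots> \<le> (\<Sum>j. M * d (j + n))"
      using 3 by (intro suminf_le sn sd') auto
    also have "\<dots> = M * (\<Sum>j. d (j + n))"
      using sd by (intro suminf_mult) (simp add: summable_iff_shift)
    finally show ?thesis .
  qed
  with L that show thesis by (auto simp: M_def)
qed

text \<open>With limit zero, the preceding estimate started at \<open>n\<close> bounds
  \<open>norm (v n)\<close> by itself times a factor that tends to zero; once the factor is below
  one, \<open>v n\<close> vanishes.\<close>

lemma eventually_zero_of_small_relative_steps:
  fixes v :: "nat \<Rightarrow> 'a::banach"
  assumes sd: "summable d" and d0: "\<And>n. 0 \<le> d n"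
    and step: "\<And>n. norm (v (Suc n) - v n) \<le> d n * norm (v n)"
    and lim: "v \<longlonglongrightarrow> 0"
  obtains n where "v n = 0"
proof -
  have "(\<lambda>n. \<Sum>j. d (j + n)) \<longlonglongrightarrow> 0"
    using suminf_exist_split[OF _ sd] by (intro LIMSEQ_I) simp
  then have "(\<lambda>n. exp (suminf d) * (\<Sum>j. d (j + n))) \<longlonglongrightarrow> exp (suminf d) * 0"
    by (intro tendsto_intros)
  then have "eventually (\<lambda>n. exp (suminf d) * (\<Sum>j. d (j + n)) < 1) sequentially"
    by (rule order_tendstoD) simp
  then obtain n where n: "exp (suminf d) * (\<Sum>j. d (j + n)) < 1"
    by (auto simp: eventually_sequentially)
  have sdn: "summable (\<lambda>j. d (j + n))" using sd by (simp add: summable_iff_shift)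
  \<comment> \<open>Starting the sequence at \<open>n\<close> puts \<open>norm (v n)\<close> instead
    of \<open>norm (v 0)\<close> on the right.\<close>
  obtain L where L: "(\<lambda>j. v (j + n)) \<longlonglongrightarrow> L"
    "\<And>m. norm (L - v (m + n)) \<le>
      exp (\<Sum>j. d (j + n)) * norm (v (0 + n)) * (\<Sum>j. d (j + m + n))"
    by (rule limit_of_small_relative_steps[of "\<lambda>j. d (j + n)" "\<lambda>j. v (j + n)"])
      (use sdn d0 step in auto)
  have "L = 0"
    using L(1) LIMSEQ_ignore_initial_segment[OF lim, of n] LIMSEQ_unique by blast
  with L(2)[of 0] have "norm (v n) \<le> exp (\<Sum>j. d (j + n)) * (\<Sum>j. d (j + n)) * norm (v n)"
    by (simp add: mult_ac)
  also have "\<dots> \<le> exp (suminf d) * (\<Sum>j. d (j + n)) * norm (v n)"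
  proof -
    have "(\<Sum>j. d (j + n)) \<le> suminf d"
      using suminf_split_initial_segment[OF sd, of n] sum_nonneg[of "{..<n}" d] d0 by simp
    then show ?thesis
      using d0 by (intro mult_right_mono) (auto intro!: suminf_nonneg sdn)
  qed
  finally have "(1 - exp (suminf d) * (\<Sum>j. d (j + n))) * norm (v n) \<le> 0"
    by (simp add: algebra_simps)
  with n have "norm (v n) \<le> 0" by (simp add: mult_le_0_iff)
  with that show thesis by simp
qed

section \<open>One step of the recurrence\<close>

text \<open>
  \<open>A, B\<close> are the amplitudes on the interval \<open>[n - 1, n]\<close> and \<open>A', B'\<close> those on
  \<open>[n, n + 1]\<close>. The free recurrence \<open>U2 = 2 Re t U1 - U0\<close> would leave them unchanged if \<open>t = t'\<close>.
\<close>

lemma amplitude_step: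
  fixes A B A' B' U2 t t' w :: complex and k s :: real
  assumes t: "cmod t = 1" and s: "0 < s" "s \<le> Im t" and k: "k \<ge> 1 / 2"
    and rec: "of_real k * U2 = (t + cnj t + w) * (A + B) - (A * t' + B * cnj t')"
    and 1: "A' + B' = A + B" and 2: "A' * cnj t + B' * t = U2"
  shows "cmod (A' - A) \<le> (cmod (t - t') + \<bar>k - 1\<bar> + cmod w) / s * (cmod A + cmod B)"
    and "B' - B = - (A' - A)"
proof -
  show BB: "B' - B = - (A' - A)" using 1 by (simp add: algebra_simps add_eq_0_iff)
  \<comment> \<open>By \<open>1\<close> and \<open>2\<close>, \<open>r\<close> is the gap between
    \<open>U2\<close> and the value \<open>A * cnj t + B * t\<close> given by the old
    amplitudes.\<close>
  define r where "r = (A' - A) * (cnj t - t)"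
  have B': "B' = B - (A' - A)" using BB by (simp add: algebra_simps)
  \<comment> \<open>Three sources of error remain: the change of ratio, the term with
    \<open>w\<close>, and the deviation of \<open>k\<close> from one.\<close>
  have "of_real k * r = A * (t - t') + B * cnj (t - t') + w * (A + B)
      + of_real (1 - k) * (A * cnj t + B * t)"
  proof -
    have "r = U2 - (A * cnj t + B * t)"
      using 2 unfolding r_def B' by (simp add: algebra_simps)
    moreover have "cnj (t - t') = cnj t - cnj t'" "of_real (1 - k) = 1 - (of_real k :: complex)"
      by simp_all
    ultimately show ?thesis using rec by algebra
  qed
  then have "k * cmod r = cmod (A * (t - t') + B * cnj (t - t') + w * (A + B)
      + of_real (1 - k) * (A * cnj t + B * t))"
    using k by (metis norm_mult norm_of_real abs_of_nonneg order_trans zero_le_divide_1_iff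
        zero_le_numeral)
  also have "\<dots> \<le> cmod A * cmod (t - t') + cmod B * cmod (t - t') + cmod w * (cmod A + cmod B)
      + \<bar>k - 1\<bar> * (cmod A + cmod B)"
  proof (intro order_trans[OF norm_triangle_ineq] add_mono)
    show "cmod (B * cnj (t - t')) \<le> cmod B * cmod (t - t')"
      by (simp only: norm_mult complex_mod_cnj)
    show "cmod (w * (A + B)) \<le> cmod w * (cmod A + cmod B)"
      by (simp add: norm_mult mult_left_mono norm_triangle_ineq)
    have "cmod (A * cnj t + B * t) \<le> cmod A + cmod B"
      using norm_triangle_ineq[of "A * cnj t" "B * t"] t by (simp add: norm_mult)
    then show "cmod (of_real (1 - k) * (A * cnj t + B * t)) \<le> \<bar>k - 1\<bar> * (cmod A + cmod B)"
      unfolding norm_mult norm_of_real by (simp add: mult_left_mono abs_minus_commute)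
  qed (simp add: norm_mult)
  finally have kr: "k * cmod r \<le> (cmod (t - t') + \<bar>k - 1\<bar> + cmod w) * (cmod A + cmod B)"
    by (simp add: algebra_simps)
  \<comment> \<open>This factor has modulus \<open>2 * Im t\<close>, at least \<open>2 * s\<close>;
    the 2 offsets the lower bound 1/2 for \<open>k\<close>.\<close>
  have "cnj t - t = - (2 * \<i> * of_real (Im t))" by (simp add: complex_eq_iff)
  then have "cmod r = cmod (A' - A) * (2 * Im t)"
    using s unfolding r_def norm_mult by (simp add: norm_mult)
  then have "cmod (A' - A) * s \<le> 1 / 2 * cmod r"
    using mult_left_mono[OF s(2), of "cmod (A' - A)"] by simp
  also have "\<dots> \<le> k * cmod r" using k by (intro mult_right_mono) auto
  finally show "cmod (A' - A) \<le> (cmod (t - t') + \<bar>k - 1\<bar> + cmod w) / s * (cmod A + cmod B)"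
    using kr s by (simp add: pos_le_divide_eq)
qed

text \<open>The real parts differ by \<open>x - y\<close>. The imaginary parts are the square roots;
  their difference times their sum is \<open>y^2 - x^2\<close>, and the sum is at least
  \<open>2 * s\<close>.\<close>

lemma unit_circle_lipschitz:
  fixes x y s :: real
  assumes s: "0 < s" "s \<le> sqrt (1 - x\<^sup>2)" "s \<le> sqrt (1 - y\<^sup>2)" and "\<bar>x\<bar> \<le> 1" "\<bar>y\<bar> \<le> 1"
  shows "cmod (cis (arccos x) - cis (arccos y)) \<le> (1 + 1 / s) * \<bar>x - y\<bar>"
proof -
  let ?X = "sqrt (1 - x\<^sup>2)" and ?Y = "sqrt (1 - y\<^sup>2)"
  have le1: "x\<^sup>2 \<le> 1" "y\<^sup>2 \<le> 1" using assms by (simp_all add: abs_square_le_1)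
  have "(?X - ?Y) * (?X + ?Y) = (y - x) * (x + y)"
    using le1 by (simp add: algebra_simps power2_eq_square flip: real_sqrt_mult)
  then have "\<bar>?X - ?Y\<bar> * \<bar>?X + ?Y\<bar> = \<bar>y - x\<bar> * \<bar>x + y\<bar>"
    by (simp only: abs_mult[symmetric])
  moreover have "\<bar>?X + ?Y\<bar> = ?X + ?Y" using s by linarith
  ultimately have "\<bar>?X - ?Y\<bar> * (?X + ?Y) = \<bar>x - y\<bar> * \<bar>x + y\<bar>"
    by (simp only: abs_minus_commute)
  moreover have "\<bar>x - y\<bar> * \<bar>x + y\<bar> \<le> \<bar>x - y\<bar> * 2"
    using assms by (intro mult_left_mono) auto
  moreover have "\<bar>?X - ?Y\<bar> * (2 * s) \<le> \<bar>?X - ?Y\<bar> * (?X + ?Y)"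
    using s by (intro mult_left_mono) auto
  ultimately have "\<bar>?X - ?Y\<bar> * s \<le> \<bar>x - y\<bar>" by linarith
  then have "\<bar>?X - ?Y\<bar> \<le> \<bar>x - y\<bar> / s" using s by (simp add: pos_le_divide_eq)
  moreover have "cmod (cis (arccos x) - cis (arccos y)) \<le> \<bar>x - y\<bar> + \<bar>?X - ?Y\<bar>"
    using cmod_le[of "cis (arccos x) - cis (arccos y)"] assms
    by (simp add: cos_arccos_abs sin_arccos_abs)
  ultimately show ?thesis by (simp add: algebra_simps)
qed

section \<open>The Jacobi equation\<close>

lemma jacobi_solution_lincomb:
  assumes "jacobi_solution a b z F" "jacobi_solution a b z G"
  shows "jacobi_solution a b z (\<lambda>n. x * F n + y * G n)"
  unfolding jacobi_solution_def
proof
  fix n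
  have "of_real (aprev a n) * F n + of_real (b n) * F (n + 1) + of_real (a n) * F (n + 2)
      = z * F (n + 1)"
    "of_real (aprev a n) * G n + of_real (b n) * G (n + 1) + of_real (a n) * G (n + 2)
      = z * G (n + 1)"
    using assms by (auto simp: jacobi_solution_def)
  then show "of_real (aprev a n) * (x * F n + y * G n)
      + of_real (b n) * (x * F (n + 1) + y * G (n + 1))
      + of_real (a n) * (x * F (n + 2) + y * G (n + 2)) = z * (x * F (n + 1) + y * G (n + 1))"
    by algebra
qed

lemma jacobi_solution_cnj:
  assumes "jacobi_solution a b z F"
  shows "jacobi_solution a b (cnj z) (\<lambda>n. cnj (F n))"
  unfolding jacobi_solution_def
proof
  fix n
  have "cnj (of_real (aprev a n) * F n + of_real (b n) * F (n + 1) + of_real (a n) * F (n + 2))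
      = cnj (z * F (n + 1))"
    using assms by (auto simp: jacobi_solution_def)
  then show "of_real (aprev a n) * cnj (F n) + of_real (b n) * cnj (F (n + 1))
      + of_real (a n) * cnj (F (n + 2)) = cnj z * cnj (F (n + 1))"
    by simp
qed

text \<open>The Jacobi equation solved for its highest term. The initial values \<open>x\<close> and
  \<open>y\<close> are the terms of index -1 and 0, so 0 and 1 give the orthogonal
  polynomials.\<close>

fun jacobi_rec where
  "jacobi_rec a b z x y 0 = x"
| "jacobi_rec a b z x y (Suc 0) = y"
| "jacobi_rec a b z x y (Suc (Suc n)) =
    ((z - of_real (b n)) * jacobi_rec a b z x y (Suc n)
      - of_real (aprev a n) * jacobi_rec a b z x y n) / (of_real (a n) :: complex)"

locale convergent_jacobi =
  fixes a b :: "nat \<Rightarrow> real" and beta_inf :: real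
  assumes a_pos: "\<And>n. a n > 0"
    and a_inv: "summable (\<lambda>n. 1 / a n)"
    and beta_lim: "jbeta a b \<longlonglongrightarrow> beta_inf"
    and beta_inf: "\<bar>beta_inf\<bar> < 1"
    and k_sum: "summable (\<lambda>n. \<bar>jk a n - 1\<bar>)"
    and beta_sum: "summable (\<lambda>n. \<bar>jbeta a b (n + 1) - jbeta a b n\<bar>)"
begin

lemma aprev_pos: "aprev a n > 0"
  using a_pos by (simp add: aprev_def)

lemma jacobi_rec_solution: "jacobi_solution a b z (jacobi_rec a b z x y)"
  unfolding jacobi_solution_def using a_pos
  by (auto simp: field_simps less_imp_neq[symmetric])

lemma jacobi_solution_zero_forward:
  assumes "jacobi_solution a b z F" "F n = 0" "F (Suc n) = 0"
  shows "F (n + m) = 0 \<and> F (Suc (n + m)) = 0"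
proof (induction m)
  case (Suc m)
  have "of_real (aprev a (n + m)) * F (n + m) + of_real (b (n + m)) * F (n + m + 1)
      + of_real (a (n + m)) * F (n + m + 2) = z * F (n + m + 1)"
    using assms(1) by (auto simp: jacobi_solution_def)
  with Suc a_pos[of "n + m"] show ?case by simp
qed (use assms in auto)

lemma jacobi_solution_zero_backward:
  assumes "jacobi_solution a b z F"
  shows "F n = 0 \<Longrightarrow> F (Suc n) = 0 \<Longrightarrow> F 0 = 0 \<and> F (Suc 0) = 0"
proof (induction n)
  case (Suc n)
  have "of_real (aprev a n) * F n + of_real (b n) * F (n + 1)
      + of_real (a n) * F (n + 2) = z * F (n + 1)"
    using assms(1) by (auto simp: jacobi_solution_def)
  with Suc aprev_pos[of n] show ?case by simp
qed (use assms in auto)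

text \<open>Both outer coefficients are positive, so the recurrence runs in either direction: two
  adjacent zeros propagate back to the start and from there to every \<open>m\<close>.\<close>

lemma jacobi_solution_zero:
  assumes "jacobi_solution a b z F" "F n = 0" "F (Suc n) = 0"
  shows "F m = 0"
  using jacobi_solution_zero_backward[OF assms]
    jacobi_solution_zero_forward[OF assms(1), of 0 m] by simp

lemma jacobi_solution_eqI:
  assumes "jacobi_solution a b z F" "jacobi_solution a b z G" "F 0 = G 0" "F 1 = G 1"
  shows "F = G"
proof
  fix m
  have "1 * F m + (-1) * G m = 0"
    by (rule jacobi_solution_zero[where n = 0, OF jacobi_solution_lincomb[OF assms(1,2)]])
      (use assms in auto)
  then show "F m = G m" by simp
qed

lemma orth_solution_eq: "orth_solution a b z = jacobi_rec a b z 0 1"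
  unfolding orth_solution_def
proof (rule the_equality)
  fix F assume "jacobi_solution a b z F \<and> F 0 = 0 \<and> F 1 = 1"
  then show "F = jacobi_rec a b z 0 1"
    by (intro jacobi_solution_eqI[OF _ jacobi_rec_solution]) auto
qed (simp add: jacobi_rec_solution)

text \<open>At a fixed index the solution is a polynomial in \<open>z\<close>, hence bounded on
  discs. Two neighbouring indices are carried because the recurrence has order two.\<close>

lemma jacobi_rec_bounded:
  "\<exists>M. \<forall>z. cmod z \<le> r \<longrightarrow>
    cmod (jacobi_rec a b z x y n) \<le> M \<and> cmod (jacobi_rec a b z x y (Suc n)) \<le> M"
proof (induction n)
  case 0
  show ?case by (intro exI[of _ "max (cmod x) (cmod y)"]) auto
next
  case (Suc n)
  then obtain M where M: "\<And>z. cmod z \<le> r \<Longrightarrow> cmod (jacobi_rec a b z x y n) \<le> M"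
    "\<And>z. cmod z \<le> r \<Longrightarrow> cmod (jacobi_rec a b z x y (Suc n)) \<le> M" by blast
  let ?M = "((r + \<bar>b n\<bar>) * M + aprev a n * M) / a n"
  have "cmod (jacobi_rec a b z x y (Suc (Suc n))) \<le> ?M" if z: "cmod z \<le> r" for z
  proof -
    have "cmod (z - of_real (b n)) \<le> r + \<bar>b n\<bar>"
      using z norm_triangle_ineq4[of z "of_real (b n)"] by simp
    then have "cmod ((z - of_real (b n)) * jacobi_rec a b z x y (Suc n)
      - of_real (aprev a n) * jacobi_rec a b z x y n) \<le> (r + \<bar>b n\<bar>) * M + aprev a n * M"
      using M[OF z] aprev_pos[of n] order_trans[OF norm_ge_zero z]
      by (intro order_trans[OF norm_triangle_ineq4] add_mono)
         (auto simp: norm_mult intro!: mult_mono)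
    then show ?thesis using a_pos[of n] by (simp add: norm_divide divide_right_mono)
  qed
  with M(2) show ?case by (intro exI[of _ "max M ?M"]) (auto simp: le_max_iff_disj)
qed

text \<open>The summand of the remainder series. At \<open>m = 0\<close> truncated subtraction makes
  the difference of betas zero; the remainder uses only \<open>m \<ge> 1\<close>.\<close>

definition delta :: "complex \<Rightarrow> nat \<Rightarrow> real" where
  "delta z m = \<bar>jbeta a b (m - 1) - jbeta a b m\<bar> + \<bar>jk a m - 1\<bar> + jalpha a m * cmod z"

lemma remainder_eq: "remainder a b n z = (\<Sum>j. delta z (j + n + 1))"
  by (simp add: remainder_def delta_def Let_def)

lemma jalpha_pos: "jalpha a n > 0"
  using a_pos aprev_pos by (simp add: jalpha_def)

lemma delta_nonneg: "0 \<le> delta z m"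
  using jalpha_pos[of m] by (simp add: delta_def)

lemma delta_mono: "cmod z \<le> cmod w \<Longrightarrow> delta z m \<le> delta w m"
  using jalpha_pos[of m] by (simp add: delta_def)

text \<open>The arithmetic-geometric mean inequality compares with \<open>1 / a n\<close>. The index
  starts at \<open>Suc n\<close> to avoid the conventional value
  \<open>aprev a 0 = 1 / 2\<close>.\<close>

lemma summable_jalpha: "summable (jalpha a)"
proof -
  have "jalpha a (Suc n) \<le> 1 / a n + 1 / a (Suc n)" for n
  proof -
    define x y where "x = 1 / a n" and "y = 1 / a (Suc n)"
    have xy: "x > 0" "y > 0" using a_pos by (auto simp: x_def y_def)
    have "jalpha a (Suc n) = sqrt (x * y) / 2"
      by (simp add: jalpha_def aprev_def x_def y_def real_sqrt_divide real_sqrt_mult)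
    also have "\<dots> \<le> x + y"
      using xy arith_geo_mean_sqrt[of x y] by simp
    finally show ?thesis by (simp add: x_def y_def)
  qed
  then have 1: "norm (jalpha a (Suc n)) \<le> 1 / a n + 1 / a (Suc n)" for n
    using jalpha_pos[of "Suc n"] by simp
  have "summable (\<lambda>n. 1 / a n + 1 / a (Suc n))"
    using a_inv by (intro summable_add) (simp_all add: summable_Suc_iff[of "\<lambda>n. 1 / a n"])
  then have "summable (\<lambda>n. jalpha a (Suc n))"
    by (rule summable_comparison_test'[where N = 0]) (rule 1)
  then show ?thesis by (simp add: summable_Suc_iff)
qed

lemma summable_delta: "summable (delta z)"
proof -
  have "summable (\<lambda>n. \<bar>jbeta a b (Suc n - 1) - jbeta a b (Suc n)\<bar>)"
    using beta_sum by (simp add: abs_minus_commute)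
  then have "summable (\<lambda>n. \<bar>jbeta a b (n - 1) - jbeta a b n\<bar>)"
    by (subst (asm) summable_Suc_iff)
  then show ?thesis unfolding delta_def
    by (intro summable_add k_sum summable_mult2 summable_jalpha)
qed

lemma summable_delta_shift: "summable (\<lambda>j. delta z (j + n))"
  using summable_delta by (simp add: summable_iff_shift)

section \<open>Variation of constants\<close>

text \<open>When \<open>\<bar>jbeta a b n\<bar> \<le> 1\<close>, this number and its conjugate are
  the roots of \<open>x^2 - 2 * jbeta a b n * x + 1\<close>, the multipliers of the free
  recurrence.\<close>

definition ratio :: "nat \<Rightarrow> complex" where
  "ratio n = cis (arccos (jbeta a b n))"

definition wave :: "nat \<Rightarrow> complex" where
  "wave n = cis (phase a b n)"

text \<open>The factor compensates the expected size \<open>1 / sqrt (a n)\<close> of solutions, and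
  \<open>Suc n\<close> undoes the index shift.\<close>

definition scaled :: "(nat \<Rightarrow> complex) \<Rightarrow> nat \<Rightarrow> complex" where
  "scaled F n = of_real (sqrt (a n)) * F (Suc n)"

text \<open>
  For \<open>v = amplitude F n\<close> one has \<open>scaled F j = fst v * cnj (wave j) + snd v * wave j\<close>
  at both \<open>j = n\<close> and \<open>j = n + 1\<close>, provided that \<open>\<bar>jbeta a b n\<bar> < 1\<close>.
\<close>

definition amplitude :: "(nat \<Rightarrow> complex) \<Rightarrow> nat \<Rightarrow> complex \<times> complex" where
  "amplitude F n =
    (wave n * (ratio n * scaled F n - scaled F (Suc n)) / (ratio n - cnj (ratio n)),
     cnj (wave n) * (scaled F (Suc n) - cnj (ratio n) * scaled F n) / (ratio n - cnj (ratio n)))"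

lemma norm_wave [simp]: "cmod (wave n) = 1" by (simp add: wave_def)
lemma norm_ratio [simp]: "cmod (ratio n) = 1" by (simp add: ratio_def)

lemma wave_cnj: "wave n * cnj (wave n) = 1"
  by (simp add: complex_norm_square[symmetric])

lemma ratio_cnj: "ratio n * cnj (ratio n) = 1"
  by (simp add: complex_norm_square[symmetric])

lemma wave_Suc:
  assumes "\<bar>jbeta a b n\<bar> \<le> 1"
  shows "wave (Suc n) = wave n * ratio n"
proof -
  have "{m. m < Suc n \<and> \<bar>jbeta a b m\<bar> \<le> 1} = insert n {m. m < n \<and> \<bar>jbeta a b m\<bar> \<le> 1}"
    using assms by auto
  then have "phase a b (Suc n) = phase a b n + arccos (jbeta a b n)"
    unfolding phase_def by simp
  then show ?thesis by (simp add: wave_def ratio_def cis_mult)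
qed

lemma ratio_Re_Im:
  assumes "\<bar>jbeta a b n\<bar> \<le> 1"
  shows "Re (ratio n) = jbeta a b n" "Im (ratio n) = sqrt (1 - (jbeta a b n)\<^sup>2)"
  using assms by (simp_all add: ratio_def cos_arccos_abs sin_arccos_abs)

lemma ratio_neq_cnj:
  assumes "\<bar>jbeta a b n\<bar> < 1"
  shows "ratio n \<noteq> cnj (ratio n)"
proof -
  have "(jbeta a b n)\<^sup>2 < 1" using assms by (simp add: abs_square_less_1)
  then show ?thesis using ratio_Re_Im[of n] assms by (auto simp: complex_eq_iff)
qed

text \<open>The definition of \<open>amplitude\<close> is Cramer's rule for these two equations,
  with determinant \<open>ratio n - cnj (ratio n)\<close>.\<close>

lemma scaled_amplitude:
  assumes "\<bar>jbeta a b n\<bar> < 1"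
  shows "scaled F n = fst (amplitude F n) * cnj (wave n) + snd (amplitude F n) * wave n"
    and "scaled F (Suc n) =
      fst (amplitude F n) * cnj (wave n) * cnj (ratio n) + snd (amplitude F n) * wave n * ratio n"
proof -
  define d where "d = ratio n - cnj (ratio n)"
  have d: "d \<noteq> 0" using ratio_neq_cnj[OF assms] by (simp add: d_def)
  have *: "fst (amplitude F n) * cnj (wave n) = (ratio n * scaled F n - scaled F (Suc n)) / d"
    "snd (amplitude F n) * wave n = (scaled F (Suc n) - cnj (ratio n) * scaled F n) / d"
    using wave_cnj[of n] by (simp_all add: amplitude_def d_def mult_ac)
  have "fst (amplitude F n) * cnj (wave n) + snd (amplitude F n) * wave n = d * scaled F n / d"
    unfolding * add_divide_distrib[symmetric] by (simp add: d_def algebra_simps)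
  with d show "scaled F n = fst (amplitude F n) * cnj (wave n) + snd (amplitude F n) * wave n"
    by simp
  have "fst (amplitude F n) * cnj (wave n) * cnj (ratio n) + snd (amplitude F n) * wave n * ratio n
      = (d * scaled F (Suc n) + scaled F n * (ratio n * cnj (ratio n) - ratio n * cnj (ratio n))) / d"
    unfolding * times_divide_eq_left add_divide_distrib[symmetric]
    by (simp add: d_def algebra_simps)
  with d show "scaled F (Suc n) =
      fst (amplitude F n) * cnj (wave n) * cnj (ratio n) + snd (amplitude F n) * wave n * ratio n"
    by simp
qed

text \<open>Dividing the Jacobi equation of index \<open>n + 1\<close> by \<open>sqrt (a n)\<close>
  produces exactly the three normalized coefficients. With \<open>jk\<close> equal to 1 and no
  \<open>z\<close> term it is the free recurrence.\<close>

lemma scaled_recurrence: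
  assumes "jacobi_solution a b z F"
  shows "of_real (jk a (Suc n)) * scaled F (Suc (Suc n)) =
    (of_real (2 * jbeta a b (Suc n)) + of_real (2 * jalpha a (Suc n)) * z) * scaled F (Suc n)
      - scaled F n"
proof -
  define p q r where "p = sqrt (a n)" and "q = sqrt (a (Suc n))" and "r = sqrt (a (Suc (Suc n)))"
  have pos: "p > 0" "q > 0" "r > 0" using a_pos by (auto simp: p_def q_def r_def)
  have sq: "a n = p\<^sup>2" "a (Suc n) = q\<^sup>2" "a (Suc (Suc n)) = r\<^sup>2"
    using a_pos by (simp_all add: p_def q_def r_def less_imp_le)
  have eq: "of_real (p\<^sup>2) * F (Suc n) + of_real (b (Suc n)) * F (Suc (Suc n))
      + of_real (q\<^sup>2) * F (Suc (Suc (Suc n))) = z * F (Suc (Suc n))"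
    using assms[unfolded jacobi_solution_def, rule_format, of "Suc n"]
    by (simp add: aprev_def sq)
  have *: "jk a (Suc n) = q\<^sup>2 / (p * r)" "jbeta a b (Suc n) = - b (Suc n) / (2 * (p * q))"
    "jalpha a (Suc n) = 1 / (2 * (p * q))"
    by (simp_all add: jk_def jbeta_def jalpha_def aprev_def p_def q_def r_def real_sqrt_mult
        a_pos less_imp_le)
  have ne: "complex_of_real p \<noteq> 0" "complex_of_real q \<noteq> 0" "complex_of_real r \<noteq> 0"
    using pos by auto
  have q2: "of_real (q\<^sup>2) * F (Suc (Suc (Suc n))) =
      z * F (Suc (Suc n)) - of_real (p\<^sup>2) * F (Suc n) - of_real (b (Suc n)) * F (Suc (Suc n))"
    using eq by (simp add: algebra_simps)
  have "of_real (jk a (Suc n)) * scaled F (Suc (Suc n))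
      = (of_real (q\<^sup>2) * F (Suc (Suc (Suc n)))) / of_real p"
    using ne by (simp add: * scaled_def flip: r_def)
  also have "\<dots> = (of_real (2 * jbeta a b (Suc n)) + of_real (2 * jalpha a (Suc n)) * z)
      * scaled F (Suc n) - scaled F n"
    unfolding q2 using ne
    by (simp add: * scaled_def flip: q_def p_def) (simp add: field_simps power2_eq_square)
  finally show ?thesis .
qed

section \<open>Estimates for the amplitudes, uniform in the spectral parameter\<close>

lemma eventually_elliptic:
  obtains N s where "s > 0"
    "\<And>n. n \<ge> N \<Longrightarrow> \<bar>jbeta a b n\<bar> < 1 \<and> s \<le> sqrt (1 - (jbeta a b n)\<^sup>2) \<and> 1 / 2 \<le> jk a n"
proof -
  \<comment> \<open>Half the limit of the imaginary part of \<open>ratio n\<close>, so that it is a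
    lower bound from some index on. Like that index, it does not depend on \<open>z\<close>.\<close>
  define s where "s = sqrt (1 - beta_inf\<^sup>2) / 2"
  have s: "s > 0" using beta_inf by (simp add: s_def abs_square_less_1)
  have "(\<lambda>n. sqrt (1 - (jbeta a b n)\<^sup>2)) \<longlonglongrightarrow> sqrt (1 - beta_inf\<^sup>2)"
    by (intro tendsto_intros beta_lim)
  then have "\<forall>\<^sub>F n in sequentially. s < sqrt (1 - (jbeta a b n)\<^sup>2)"
    by (rule order_tendstoD) (use s in \<open>simp add: s_def\<close>)
  moreover have "\<forall>\<^sub>F n in sequentially. \<bar>jbeta a b n\<bar> < 1"
    by (rule order_tendstoD(2)[OF tendsto_rabs[OF beta_lim] beta_inf])
  moreover have "\<forall>\<^sub>F n in sequentially. \<bar>jk a n - 1\<bar> < 1 / 2"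
    by (rule order_tendstoD(2)[OF summable_LIMSEQ_zero[OF k_sum]]) simp
  ultimately have "\<forall>\<^sub>F n in sequentially. \<bar>jbeta a b n\<bar> < 1 \<and>
      s \<le> sqrt (1 - (jbeta a b n)\<^sup>2) \<and> 1 / 2 \<le> jk a n"
    by eventually_elim (auto simp: abs_if split: if_splits)
  with s that show thesis by (auto simp: eventually_sequentially)
qed

lemma amplitude_relative_step:
  obtains N C where "C \<ge> 0" "\<And>n. n \<ge> N \<Longrightarrow> \<bar>jbeta a b n\<bar> < 1"
    "\<And>n z F. n \<ge> N \<Longrightarrow> jacobi_solution a b z F \<Longrightarrow>
      norm (amplitude F (Suc n) - amplitude F n) \<le> C * delta z (Suc n) * norm (amplitude F n)"
proof -
  obtain N s where s: "s > 0" and N: "\<And>n. n \<ge> N \<Longrightarrow>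
      \<bar>jbeta a b n\<bar> < 1 \<and> s \<le> sqrt (1 - (jbeta a b n)\<^sup>2) \<and> 1 / 2 \<le> jk a n"
    by (rule eventually_elliptic) blast
  \<comment> \<open>Large enough for the Lipschitz constant \<open>1 + 1 / s\<close> and for the 2
    in \<open>2 * jalpha\<close>.\<close>
  define D where "D = 2 + 1 / s"
  have D: "D \<ge> 2" using s by (simp add: D_def)
  \<comment> \<open>The 4 collects a 2 from \<open>cmod ?p + cmod ?q\<close> and a 2 from the two
    components, whose changes have equal modulus.\<close>
  have "norm (amplitude F (Suc n) - amplitude F n)
      \<le> 4 * D / s * delta z (Suc n) * norm (amplitude F n)"
    if n: "n \<ge> N" and F: "jacobi_solution a b z F" for n z F
  proof -
    let ?w = "wave (Suc n)" and ?t = "ratio (Suc n)" and ?t' = "ratio n"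
    let ?p = "fst (amplitude F n)" and ?q = "snd (amplitude F n)"
    let ?p' = "fst (amplitude F (Suc n))" and ?q' = "snd (amplitude F (Suc n))"
    have Nn: "\<bar>jbeta a b n\<bar> < 1" "\<bar>jbeta a b (Suc n)\<bar> < 1" using N n by auto
    have w: "?w = wave n * ?t'" using Nn by (intro wave_Suc) auto
    have u1: "scaled F (Suc n) = ?p * cnj ?w + ?q * ?w"
      using scaled_amplitude(2)[OF Nn(1), of F] by (simp add: w mult_ac)
    have "wave n = ?w * cnj ?t'" using ratio_cnj[of n] by (simp add: w mult.assoc)
    then have u0: "scaled F n = ?p * cnj ?w * ?t' + ?q * ?w * cnj ?t'"
      using scaled_amplitude(1)[OF Nn(1), of F] by (simp add: mult_ac)
    have tt: "?t + cnj ?t = of_real (2 * jbeta a b (Suc n))"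
      using ratio_Re_Im[of "Suc n"] Nn by (simp add: complex_eq_iff)
    have sI: "s \<le> Im ?t" using N[of "Suc n"] n ratio_Re_Im[of "Suc n"] by simp
    have k: "1 / 2 \<le> jk a (Suc n)" using N[of "Suc n"] n by simp
    \<comment> \<open>The waves at \<open>n + 1\<close> are absorbed into the amplitudes; being
      unimodular, they leave all moduli unchanged.\<close>
    note st = amplitude_step[of ?t s "jk a (Suc n)" "scaled F (Suc (Suc n))"
        "of_real (2 * jalpha a (Suc n)) * z" "?p * cnj ?w" "?q * ?w" ?t' "?p' * cnj ?w" "?q' * ?w",
        OF norm_ratio s sI k]
    have rec: "of_real (jk a (Suc n)) * scaled F (Suc (Suc n)) =
      (?t + cnj ?t + of_real (2 * jalpha a (Suc n)) * z) * (?p * cnj ?w + ?q * ?w)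
      - (?p * cnj ?w * ?t' + ?q * ?w * cnj ?t')"
      using scaled_recurrence[OF F, of n] unfolding tt u1 u0[symmetric] .
    have 1: "?p' * cnj ?w + ?q' * ?w = ?p * cnj ?w + ?q * ?w"
      using scaled_amplitude(1)[OF Nn(2), of F] u1 by simp
    have 2: "?p' * cnj ?w * cnj ?t + ?q' * ?w * ?t = scaled F (Suc (Suc n))"
      using scaled_amplitude(2)[OF Nn(2), of F] by simp
    note st = st[OF rec 1 2]
    have "cmod (?t - ?t') \<le> (1 + 1 / s) * \<bar>jbeta a b (Suc n) - jbeta a b n\<bar>"
      unfolding ratio_def using N[of n] N[of "Suc n"] n s
      by (intro unit_circle_lipschitz) auto
    also have "\<dots> \<le> D * \<bar>jbeta a b n - jbeta a b (Suc n)\<bar>"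
      by (simp add: D_def abs_minus_commute mult_right_mono)
    finally have "cmod (?t - ?t') \<le> D * \<bar>jbeta a b n - jbeta a b (Suc n)\<bar>" .
    moreover have "\<bar>jk a (Suc n) - 1\<bar> \<le> D * \<bar>jk a (Suc n) - 1\<bar>"
      using D mult_right_mono[of 1 D "\<bar>jk a (Suc n) - 1\<bar>"] by simp
    moreover have "cmod (of_real (2 * jalpha a (Suc n)) * z) \<le> D * (jalpha a (Suc n) * cmod z)"
      using D jalpha_pos[of "Suc n"] mult_right_mono[of 2 D "jalpha a (Suc n) * cmod z"]
      by (simp add: norm_mult)
    ultimately have dl: "cmod (?t - ?t') + \<bar>jk a (Suc n) - 1\<bar>
        + cmod (of_real (2 * jalpha a (Suc n)) * z) \<le> D * delta z (Suc n)"
      by (simp add: delta_def algebra_simps)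
    have pq: "cmod ?p + cmod ?q \<le> 2 * norm (amplitude F n)"
      using norm_fst_le[of ?p ?q] norm_snd_le[of ?q ?p] by simp
    have "cmod (?p' - ?p) = cmod (?p' * cnj ?w - ?p * cnj ?w)"
      by (simp add: norm_mult flip: left_diff_distrib)
    also have "\<dots> \<le> (cmod (?t - ?t') + \<bar>jk a (Suc n) - 1\<bar>
        + cmod (of_real (2 * jalpha a (Suc n)) * z)) / s * (cmod ?p + cmod ?q)"
      using st(1) by (simp add: norm_mult)
    also have "\<dots> \<le> D * delta z (Suc n) / s * (2 * norm (amplitude F n))"
      using s dl pq D delta_nonneg[of z "Suc n"]
      by (intro mult_mono divide_right_mono) auto
    finally have p: "cmod (?p' - ?p) \<le> D * delta z (Suc n) / s * (2 * norm (amplitude F n))" .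
    have "cmod (?q' - ?q) = cmod (?q' * ?w - ?q * ?w)"
      by (simp add: norm_mult flip: left_diff_distrib)
    also have "\<dots> = cmod (?p' * cnj ?w - ?p * cnj ?w)"
      unfolding st(2) by (rule norm_minus_cancel)
    also have "\<dots> = cmod (?p' - ?p)"
      by (simp add: norm_mult flip: left_diff_distrib)
    finally have "norm (amplitude F (Suc n) - amplitude F n) \<le> 2 * cmod (?p' - ?p)"
      using norm_Pair_le[of "?p' - ?p" "?q' - ?q"]
      by (metis fst_diff snd_diff prod.collapse mult_2)
    with p show ?thesis by simp
  qed
  then show thesis using that[of "4 * D / s" N] N D s by auto
qed

text \<open>The two sequence lemmas applied from \<open>N\<close> on. A step from \<open>n\<close>
  to \<open>n + 1\<close> costs a multiple of \<open>delta z (n + 1)\<close>, so the tail from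
  \<open>n\<close> is a multiple of \<open>remainder a b n z\<close>. \<open>N\<close> and
  \<open>C\<close> are chosen before \<open>z\<close> and \<open>F\<close>.\<close>

lemma amplitude_limit:
  obtains N C where "C \<ge> 0" "\<And>n. n \<ge> N \<Longrightarrow> \<bar>jbeta a b n\<bar> < 1"
    "\<And>z F. jacobi_solution a b z F \<Longrightarrow> \<exists>L. amplitude F \<longlonglongrightarrow> L \<and>
      (\<forall>n\<ge>N. norm (L - amplitude F n) \<le>
        C * exp (C * remainder a b N z) * norm (amplitude F N) * remainder a b n z)"
    "\<And>z F. jacobi_solution a b z F \<Longrightarrow> amplitude F \<longlonglongrightarrow> 0 \<Longrightarrow> \<exists>n\<ge>N. amplitude F n = 0"
proof -
  obtain N C where C: "C \<ge> 0" and N: "\<And>n. n \<ge> N \<Longrightarrow> \<bar>jbeta a b n\<bar> < 1"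
    and step: "\<And>n z F. n \<ge> N \<Longrightarrow> jacobi_solution a b z F \<Longrightarrow>
      norm (amplitude F (Suc n) - amplitude F n) \<le> C * delta z (Suc n) * norm (amplitude F n)"
    by (rule amplitude_relative_step) (rule that, assumption, blast, blast)
  have sd: "summable (\<lambda>j. C * delta z (Suc (j + N)))" for z
    using summable_delta_shift[of z "Suc N"] by (intro summable_mult) simp
  have tail: "(\<Sum>j. C * delta z (Suc (j + m))) = C * remainder a b m z" for m z
    unfolding remainder_eq using summable_delta_shift[of z "Suc m"]
    by (subst suminf_mult[symmetric]) simp_all
  show thesis
  proof (rule that[OF C N])
    fix z F assume F: "jacobi_solution a b z F"
    obtain L where L: "(\<lambda>j. amplitude F (j + N)) \<longlonglongrightarrow> L"
      "\<And>n. norm (L - amplitude F (n + N)) \<le> exp (\<Sum>j. C * delta z (Suc (j + N)))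
        * norm (amplitude F (0 + N)) * (\<Sum>j. C * delta z (Suc (j + n + N)))"
      by (rule limit_of_small_relative_steps[of "\<lambda>j. C * delta z (Suc (j + N))"
            "\<lambda>j. amplitude F (j + N)"])
        (use sd C delta_nonneg step F in auto)
    have "norm (L - amplitude F n) \<le>
        C * exp (C * remainder a b N z) * norm (amplitude F N) * remainder a b n z" if "n \<ge> N" for n
      using L(2)[of "n - N"] that tail[of z N] tail[of z n] by (simp add: mult_ac)
    with L(1) show "\<exists>L. amplitude F \<longlonglongrightarrow> L \<and> (\<forall>n\<ge>N. norm (L - amplitude F n) \<le>
        C * exp (C * remainder a b N z) * norm (amplitude F N) * remainder a b n z)"
      using LIMSEQ_offset[of "amplitude F" N L] by blast
  next
    fix z F assume F: "jacobi_solution a b z F" and "amplitude F \<longlonglongrightarrow> 0"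
    then have "(\<lambda>j. amplitude F (j + N)) \<longlonglongrightarrow> 0" by (intro LIMSEQ_ignore_initial_segment)
    then obtain n where "amplitude F (n + N) = 0"
      using eventually_zero_of_small_relative_steps[of "\<lambda>j. C * delta z (Suc (j + N))"
          "\<lambda>j. amplitude F (j + N)"] sd C delta_nonneg step F by auto
    then show "\<exists>n\<ge>N. amplitude F n = 0" by (intro exI[of _ "n + N"]) simp
  qed auto
qed

section \<open>Solutions and their limit amplitudes\<close>

lemma amplitude_lincomb:
  "amplitude (\<lambda>n. x * F n + y * G n) n =
    (x * fst (amplitude F n) + y * fst (amplitude G n),
     x * snd (amplitude F n) + y * snd (amplitude G n))"
  by (simp add: amplitude_def scaled_def add_divide_distrib[symmetric] algebra_simps)

text \<open>Conjugation interchanges the two waves, hence the two components.\<close>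

lemma amplitude_cnj:
  "amplitude (\<lambda>n. cnj (F n)) n = (cnj (snd (amplitude F n)), cnj (fst (amplitude F n)))"
proof -
  have "w * (x - y) / (s - t) = w * (y - x) / (t - s)" for w x y s t :: complex
    by (metis minus_diff_eq minus_divide_divide mult_minus_right)
  then show ?thesis unfolding amplitude_def scaled_def by simp
qed

lemma amplitude_lincomb_tendsto:
  assumes "amplitude F \<longlonglongrightarrow> (p, q)" "amplitude G \<longlonglongrightarrow> (p', q')"
  shows "amplitude (\<lambda>n. x * F n + y * G n) \<longlonglongrightarrow> (x * p + y * p', x * q + y * q')"
  unfolding amplitude_lincomb
  using tendsto_fst[OF assms(1)] tendsto_fst[OF assms(2)]
    tendsto_snd[OF assms(1)] tendsto_snd[OF assms(2)]
  by (intro tendsto_intros) auto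

lemma amplitude_cnj_tendsto:
  assumes "amplitude F \<longlonglongrightarrow> (p, q)"
  shows "amplitude (\<lambda>n. cnj (F n)) \<longlonglongrightarrow> (cnj q, cnj p)"
  unfolding amplitude_cnj
  using tendsto_fst[OF assms] tendsto_snd[OF assms] by (intro tendsto_intros) auto

text \<open>Injectivity of the map to limit amplitudes: some amplitude is exactly zero, which gives
  two adjacent zeros of the solution.\<close>

lemma solution_zero_of_amplitude:
  assumes F: "jacobi_solution a b z F" and "amplitude F \<longlonglongrightarrow> (0, 0)"
  shows "F m = 0"
proof -
  obtain n where n: "\<bar>jbeta a b n\<bar> < 1" "amplitude F n = 0"
    using assms by (metis amplitude_limit zero_prod_def)
  then have "scaled F n = 0" "scaled F (Suc n) = 0"
    using scaled_amplitude[of n F] by simp_all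
  then have "F (Suc n) = 0" "F (Suc (Suc n)) = 0"
    using a_pos by (simp_all add: scaled_def less_imp_neq[symmetric])
  then show ?thesis using jacobi_solution_zero[OF F] by blast
qed

lemma solution_unique_of_amplitude:
  assumes "jacobi_solution a b z F" "jacobi_solution a b z G"
    and "amplitude F \<longlonglongrightarrow> (p, q)" "amplitude G \<longlonglongrightarrow> (p, q)"
  shows "F = G"
proof
  fix m
  have "1 * F m + (-1) * G m = 0"
    using amplitude_lincomb_tendsto[OF assms(3,4), of 1 "-1"]
    by (intro solution_zero_of_amplitude[OF jacobi_solution_lincomb[OF assms(1,2)]]) simp
  then show "F m = G m" by simp
qed

lemma amplitude_convergent:
  assumes "jacobi_solution a b z F"
  obtains p q where "amplitude F \<longlonglongrightarrow> (p, q)"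
  using assms by (metis amplitude_limit surj_pair)

text \<open>Surjectivity follows from injectivity by dimension: Cramer's rule is applied to the
  limit amplitudes of two basis solutions.\<close>

lemma solution_of_amplitude:
  obtains F where "jacobi_solution a b z F" "amplitude F \<longlonglongrightarrow> (p, q)"
proof -
  let ?F = "jacobi_rec a b z 1 0" and ?G = "jacobi_rec a b z 0 1"
  obtain p1 q1 where 1: "amplitude ?F \<longlonglongrightarrow> (p1, q1)"
    using amplitude_convergent[OF jacobi_rec_solution] .
  obtain p2 q2 where 2: "amplitude ?G \<longlonglongrightarrow> (p2, q2)"
    using amplitude_convergent[OF jacobi_rec_solution] .
  note sol = jacobi_solution_lincomb[OF jacobi_rec_solution jacobi_rec_solution]
  have inj: "x = 0 \<and> y = 0" if "x * p1 + y * p2 = 0" "x * q1 + y * q2 = 0" for x y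
  proof -
    have "x * ?F m + y * ?G m = 0" for m
      using amplitude_lincomb_tendsto[OF 1 2, of x y] that
      by (intro solution_zero_of_amplitude[OF sol]) simp
    from this[of 0] this[of 1] show ?thesis by simp
  qed
  define D where "D = p1 * q2 - p2 * q1"
  \<comment> \<open>If \<open>D = 0\<close>, then \<open>inj\<close> applies to
    \<open>(q2, - q1)\<close> and \<open>(p2, - p1)\<close>, so all four limits are zero, and
    \<open>inj\<close> at \<open>(1, 0)\<close> gives a contradiction.\<close>
  have D: "D \<noteq> 0"
  proof
    assume "D = 0"
    then have "q2 = 0" "q1 = 0" "p2 = 0" "p1 = 0"
      using inj[of q2 "- q1"] inj[of p2 "- p1"] by (auto simp: D_def algebra_simps)
    then show False using inj[of 1 0] by simp
  qed
  let ?x = "(p * q2 - q * p2) / D" and ?y = "(q * p1 - p * q1) / D"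
  have "?x * p1 + ?y * p2 = p * D / D" "?x * q1 + ?y * q2 = q * D / D"
    unfolding times_divide_eq_left add_divide_distrib[symmetric]
    by (simp_all add: D_def algebra_simps)
  then have "amplitude (\<lambda>n. ?x * ?F n + ?y * ?G n) \<longlonglongrightarrow> (p, q)"
    using amplitude_lincomb_tendsto[OF 1 2, of ?x ?y] D by simp
  with sol that show thesis by blast
qed

section \<open>Jost solutions and connection coefficients\<close>

lemma eventually_scaled_wave:
  "\<forall>\<^sub>F n in sequentially. scaled F n * wave n = fst (amplitude F n) + snd (amplitude F n) * (wave n)\<^sup>2"
proof -
  obtain N s where N: "\<And>n. n \<ge> N \<Longrightarrow>
      \<bar>jbeta a b n\<bar> < 1 \<and> s \<le> sqrt (1 - (jbeta a b n)\<^sup>2) \<and> 1 / 2 \<le> jk a n"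
    by (rule eventually_elliptic) blast
  have "scaled F n * wave n = fst (amplitude F n) + snd (amplitude F n) * (wave n)\<^sup>2"
    if "n \<ge> N" for n
  proof -
    have "scaled F n * wave n = fst (amplitude F n) * (wave n * cnj (wave n))
        + snd (amplitude F n) * (wave n)\<^sup>2"
      using N[OF that] by (subst scaled_amplitude(1)) (auto simp: algebra_simps power2_eq_square)
    then show ?thesis by (simp add: wave_cnj)
  qed
  then show ?thesis by (auto simp: eventually_sequentially)
qed

text \<open>The oscillating factor is unimodular, so the second amplitude may be replaced by its
  limit.\<close>

lemma tendsto_snd_amplitude_wave:
  assumes "amplitude F \<longlonglongrightarrow> (p, q)"
  shows "(\<lambda>n. (snd (amplitude F n) - q) * (wave n)\<^sup>2) \<longlonglongrightarrow> 0"
proof -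
  have "(\<lambda>n. cmod (snd (amplitude F n) - q)) \<longlonglongrightarrow> cmod (q - q)"
    using tendsto_snd[OF assms] by (intro tendsto_intros) simp
  then have "(\<lambda>n. cmod ((snd (amplitude F n) - q) * (wave n)\<^sup>2)) \<longlonglongrightarrow> 0"
    by (simp add: norm_mult norm_power)
  then show ?thesis by (rule tendsto_norm_zero_cancel)
qed

text \<open>
  Since \<open>wave (n + 1) / wave n\<close> tends to a number whose square is not \<open>1\<close>, a convergent
  sequence \<open>q * (wave n)\<^sup>2\<close> has limit \<open>0\<close>.
\<close>

lemma scaled_wave_tendsto_1_iff:
  assumes amp: "amplitude F \<longlonglongrightarrow> (p, q)"
  shows "(\<lambda>n. scaled F n * wave n) \<longlonglongrightarrow> 1 \<longleftrightarrow> p = 1 \<and> q = 0"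
proof
  assume "p = 1 \<and> q = 0"
  then have "(\<lambda>n. fst (amplitude F n) + (snd (amplitude F n) - q) * (wave n)\<^sup>2) \<longlonglongrightarrow> 1 + 0"
    using tendsto_fst[OF amp] tendsto_snd_amplitude_wave[OF amp] by (intro tendsto_add) auto
  moreover have "\<forall>\<^sub>F n in sequentially. fst (amplitude F n) + (snd (amplitude F n) - q) * (wave n)\<^sup>2
      = scaled F n * wave n"
    using eventually_scaled_wave[of F] by eventually_elim (use \<open>p = 1 \<and> q = 0\<close> in simp)
  ultimately show "(\<lambda>n. scaled F n * wave n) \<longlonglongrightarrow> 1"
    by (simp add: tendsto_cong)
next
  assume "(\<lambda>n. scaled F n * wave n) \<longlonglongrightarrow> 1"
  then have "(\<lambda>n. scaled F n * wave n - fst (amplitude F n)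
      - (snd (amplitude F n) - q) * (wave n)\<^sup>2) \<longlonglongrightarrow> 1 - p - 0"
    using tendsto_fst[OF amp] tendsto_snd_amplitude_wave[OF amp] by (intro tendsto_diff) auto
  moreover have "\<forall>\<^sub>F n in sequentially. scaled F n * wave n - fst (amplitude F n)
      - (snd (amplitude F n) - q) * (wave n)\<^sup>2 = q * (wave n)\<^sup>2"
    using eventually_scaled_wave[of F] by eventually_elim (simp add: algebra_simps)
  ultimately have lim: "(\<lambda>n. q * (wave n)\<^sup>2) \<longlonglongrightarrow> 1 - p"
    by (simp add: tendsto_cong)
  define R where "R = cis (arccos beta_inf)"
  have "isCont arccos beta_inf" using beta_inf by (intro isCont_arccos) auto
  then have "(\<lambda>n. arccos (jbeta a b n)) \<longlonglongrightarrow> arccos beta_inf"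
    using beta_lim by (rule isCont_tendsto_compose)
  then have R: "ratio \<longlonglongrightarrow> R"
    unfolding ratio_def R_def cis_conv_exp by (intro tendsto_intros)
  have "(\<lambda>n. q * (wave n)\<^sup>2 * (ratio n)\<^sup>2) \<longlonglongrightarrow> (1 - p) * R\<^sup>2"
    by (intro tendsto_intros lim R)
  moreover have "\<forall>\<^sub>F n in sequentially. \<bar>jbeta a b n\<bar> < 1"
    by (rule order_tendstoD(2)[OF tendsto_rabs[OF beta_lim] beta_inf])
  then have "\<forall>\<^sub>F n in sequentially. q * (wave n)\<^sup>2 * (ratio n)\<^sup>2 = q * (wave (Suc n))\<^sup>2"
    by eventually_elim (simp add: wave_Suc power_mult_distrib)
  ultimately have "(\<lambda>n. q * (wave (Suc n))\<^sup>2) \<longlonglongrightarrow> (1 - p) * R\<^sup>2"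
    by (simp add: tendsto_cong)
  moreover have "(\<lambda>n. q * (wave (Suc n))\<^sup>2) \<longlonglongrightarrow> 1 - p"
    using lim by (rule LIMSEQ_Suc)
  ultimately have "(1 - p) * R\<^sup>2 = 1 - p" by (rule LIMSEQ_unique)
  moreover have "R\<^sup>2 \<noteq> 1"
  proof
    assume "R\<^sup>2 = 1"
    then have "R = 1 \<or> R = -1" by (simp add: power2_eq_1_iff)
    then have "Im R = 0" by auto
    then have "beta_inf\<^sup>2 = 1" using beta_inf by (simp add: R_def sin_arccos_abs)
    with beta_inf show False by (simp add: abs_square_eq_1)
  qed
  ultimately have p: "p = 1" by auto
  \<comment> \<open>These moduli are constantly \<open>cmod q\<close>, while \<open>p = 1\<close>
    makes the limit zero.\<close>
  have "(\<lambda>n. cmod (q * (wave n)\<^sup>2)) \<longlonglongrightarrow> cmod (1 - p)"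
    by (intro tendsto_intros lim)
  then have "cmod q = 0" using p by (simp add: norm_mult norm_power LIMSEQ_const_iff)
  with p show "p = 1 \<and> q = 0" by simp
qed

lemma powr_minus_half: "a n powr (- 1 / 2) = 1 / sqrt (a n)"
proof -
  have "a n powr (- 1 / 2) = a n powr - (1 / 2)" by simp
  then show ?thesis
    using a_pos[of n] by (simp only: powr_minus powr_half_sqrt less_imp_le inverse_eq_divide)
qed

text \<open>The quotient by the reference sequence is exactly \<open>scaled F n * wave n\<close>;
  the reference never vanishes, so the 0/0 convention of asymptotic equivalence does not
  occur.\<close>

lemma jost_asymptotics_iff:
  "(\<lambda>n. F (n + 1)) \<sim>[sequentially]
      (\<lambda>n. of_real (a n powr (- 1 / 2)) * exp (- \<i> * of_real (phase a b n)))
    \<longleftrightarrow> (\<lambda>n. scaled F n * wave n) \<longlonglongrightarrow> 1"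
proof -
  let ?g = "\<lambda>n. complex_of_real (a n powr (- 1 / 2)) * exp (- \<i> * of_real (phase a b n))"
  have g: "?g n \<noteq> 0" for n using a_pos[of n] by simp
  have "F (n + 1) / ?g n = scaled F n * wave n" for n
    unfolding powr_minus_half
    by (simp add: scaled_def wave_def cis_conv_exp exp_minus field_simps)
  then show ?thesis using g by (simp add: asymp_equiv_def)
qed

text \<open>The defining asymptotics amounts to limit amplitudes \<open>(1, 0)\<close>, which
  exactly one solution has; so the definite description denotes it.\<close>

lemma jost_solution:
  "jacobi_solution a b z (jost_solution a b z)" "amplitude (jost_solution a b z) \<longlonglongrightarrow> (1, 0)"
proof -
  have char: "(jacobi_solution a b z F \<and> (\<lambda>n. F (n + 1)) \<sim>[sequentially]
        (\<lambda>n. of_real (a n powr (- 1 / 2)) * exp (- \<i> * of_real (phase a b n)))) \<longleftrightarrow>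
      jacobi_solution a b z F \<and> amplitude F \<longlonglongrightarrow> (1, 0)" for F
    unfolding jost_asymptotics_iff
    by (metis amplitude_convergent scaled_wave_tendsto_1_iff)
  obtain G where G: "jacobi_solution a b z G" "amplitude G \<longlonglongrightarrow> (1, 0)"
    by (rule solution_of_amplitude)
  have "jost_solution a b z = G"
    unfolding jost_solution_def char
    using G solution_unique_of_amplitude by (intro the_equality) blast+
  with G show "jacobi_solution a b z (jost_solution a b z)"
    "amplitude (jost_solution a b z) \<longlonglongrightarrow> (1, 0)" by simp_all
qed

lemma jost_conj:
  "jacobi_solution a b z (jost_conj a b z)" "amplitude (jost_conj a b z) \<longlonglongrightarrow> (0, 1)"
proof -
  have eq: "jost_conj a b z = (\<lambda>n. cnj (jost_solution a b (cnj z) n))"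
    by (simp add: fun_eq_iff jost_conj_def)
  show "jacobi_solution a b z (jost_conj a b z)"
    using jacobi_solution_cnj[OF jost_solution(1), of "cnj z"] by (simp add: eq)
  show "amplitude (jost_conj a b z) \<longlonglongrightarrow> (0, 1)"
    using amplitude_cnj_tendsto[OF jost_solution(2), of "cnj z"] by (simp add: eq)
qed

text \<open>A combination of the Jost solution and its conjugate has its coefficient pair as limit
  amplitudes; this gives existence and uniqueness of the pair.\<close>

lemma jost_coeffs_eqI:
  assumes amp: "amplitude (orth_solution a b z) \<longlonglongrightarrow> (p, q)"
  shows "jost_coeffs a b z = (p, q)"
  unfolding jost_coeffs_def
proof (rule the_equality)
  have sol: "jacobi_solution a b z (orth_solution a b z)"
    by (simp add: orth_solution_eq jacobi_rec_solution)
  note comb = amplitude_lincomb_tendsto[OF jost_solution(2)[of z] jost_conj(2)[of z]]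
  show "\<forall>n. orth_solution a b z n =
      fst (p, q) * jost_solution a b z n + snd (p, q) * jost_conj a b z n"
    using solution_unique_of_amplitude[OF sol
        jacobi_solution_lincomb[OF jost_solution(1) jost_conj(1)] amp, of p q] comb[of p q]
    by (simp add: fun_eq_iff)
  fix k assume "\<forall>n. orth_solution a b z n =
      fst k * jost_solution a b z n + snd k * jost_conj a b z n"
  then have "orth_solution a b z =
      (\<lambda>n. fst k * jost_solution a b z n + snd k * jost_conj a b z n)" by auto
  then have "amplitude (orth_solution a b z) \<longlonglongrightarrow> k"
    using comb[of "fst k" "snd k"] by simp
  then show "k = (p, q)" using amp by (rule LIMSEQ_unique)
qed

text \<open>The orthogonal polynomials have real coefficients, so conjugating them amounts to
  conjugating \<open>z\<close>; this identifies the second component.\<close>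

lemma orth_amplitude:
  "amplitude (orth_solution a b z) \<longlonglongrightarrow> (k_plus a b z, cnj (k_plus a b (cnj z)))"
proof -
  have sol: "jacobi_solution a b w (orth_solution a b w)" for w
    by (simp add: orth_solution_eq jacobi_rec_solution)
  obtain p q where pq: "amplitude (orth_solution a b z) \<longlonglongrightarrow> (p, q)"
    using amplitude_convergent[OF sol] .
  have "orth_solution a b (cnj z) = (\<lambda>n. cnj (orth_solution a b z n))"
    by (rule jacobi_solution_eqI[OF sol jacobi_solution_cnj[OF sol]])
      (simp_all add: orth_solution_eq)
  then have "amplitude (orth_solution a b (cnj z)) \<longlonglongrightarrow> (cnj q, cnj p)"
    using amplitude_cnj_tendsto[OF pq] by simp
  with pq show ?thesis by (simp add: k_plus_def jost_coeffs_eqI)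
qed

lemma remainder_nonneg: "0 \<le> remainder a b n z"
  unfolding remainder_eq using summable_delta_shift[of z "n + 1"] delta_nonneg
  by (intro suminf_nonneg) (simp_all add: add.assoc)

lemma remainder_mono: "cmod z \<le> cmod w \<Longrightarrow> remainder a b n z \<le> remainder a b n w"
  unfolding remainder_eq
  using summable_delta_shift[of z "n + 1"] summable_delta_shift[of w "n + 1"] delta_mono
  by (intro suminf_le) (simp_all add: add.assoc)

section \<open>The error term\<close>

lemma amplitude_orth_bounded:
  "\<exists>M. \<forall>z. cmod z \<le> r \<longrightarrow> norm (amplitude (orth_solution a b z) n) \<le> M"
proof -
  obtain M where M: "\<And>z. cmod z \<le> r \<Longrightarrow> cmod (orth_solution a b z (Suc n)) \<le> M"
    "\<And>z. cmod z \<le> r \<Longrightarrow> cmod (orth_solution a b z (Suc (Suc n))) \<le> M"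
    using jacobi_rec_bounded[of r 0 1 "Suc n"] unfolding orth_solution_eq by blast
  define S where "S = sqrt (a n) * M + sqrt (a (Suc n)) * M"
  \<comment> \<open>If \<open>d\<close> is zero, division by zero makes both sides of the next bound
    zero.\<close>
  define d where "d = cmod (ratio n - cnj (ratio n))"
  have "norm (amplitude (orth_solution a b z) n) \<le> S / d + S / d" if z: "cmod z \<le> r" for z
  proof -
    let ?u = "scaled (orth_solution a b z)"
    have u: "cmod (?u n) \<le> sqrt (a n) * M" "cmod (?u (Suc n)) \<le> sqrt (a (Suc n)) * M"
      using M[OF z] a_pos by (simp_all add: scaled_def norm_mult mult_left_mono less_imp_le)
    have "cmod (ratio n * ?u n - ?u (Suc n)) \<le> S"
      using u norm_triangle_ineq4[of "ratio n * ?u n" "?u (Suc n)"] by (simp add: S_def norm_mult)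
    moreover have "cmod (?u (Suc n) - cnj (ratio n) * ?u n) \<le> S"
      using u norm_triangle_ineq4[of "?u (Suc n)" "cnj (ratio n) * ?u n"]
      by (simp add: S_def norm_mult)
    ultimately show ?thesis
      unfolding amplitude_def
      by (intro order_trans[OF norm_Pair_le] add_mono)
        (simp_all add: norm_mult norm_divide d_def divide_right_mono)
  qed
  then show ?thesis by blast
qed

definition error :: "nat \<Rightarrow> complex \<Rightarrow> complex" where
  "error n z = scaled (orth_solution a b z) n
    - (k_plus a b z * cnj (wave n) + cnj (k_plus a b (cnj z)) * wave n)"

text \<open>The error is the distance of the amplitudes from their limits, carried by unimodular
  waves.\<close>

lemma error_bound:
  "\<exists>C. \<forall>\<^sub>F n in sequentially. \<forall>z. cmod z \<le> r \<longrightarrow> cmod (error n z) \<le> C * remainder a b n z"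
proof -
  obtain N C where C: "C \<ge> 0" and N: "\<And>n. n \<ge> N \<Longrightarrow> \<bar>jbeta a b n\<bar> < 1"
    and lim: "\<And>z F. jacobi_solution a b z F \<Longrightarrow> \<exists>L. amplitude F \<longlonglongrightarrow> L \<and>
      (\<forall>n\<ge>N. norm (L - amplitude F n) \<le>
        C * exp (C * remainder a b N z) * norm (amplitude F N) * remainder a b n z)"
    by (rule amplitude_limit) (rule that, assumption, blast, blast)
  obtain M where M: "\<And>z. cmod z \<le> r \<Longrightarrow> norm (amplitude (orth_solution a b z) N) \<le> M"
    using amplitude_orth_bounded by blast
  \<comment> \<open>The worst case over the disc: the remainder grows with \<open>cmod z\<close>,
    and \<open>M\<close> bounds the amplitudes at \<open>N\<close>.\<close>
  let ?E = "C * exp (C * remainder a b N (of_real r)) * M"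
  have "cmod (error n z) \<le> 2 * ?E * remainder a b n z" if n: "n \<ge> N" and z: "cmod z \<le> r" for n z
  proof -
    let ?F = "orth_solution a b z"
    let ?p = "k_plus a b z" and ?q = "cnj (k_plus a b (cnj z))"
    have "jacobi_solution a b z ?F" by (simp add: orth_solution_eq jacobi_rec_solution)
    from lim[OF this] have "norm ((?p, ?q) - amplitude ?F n) \<le>
        C * exp (C * remainder a b N z) * norm (amplitude ?F N) * remainder a b n z"
      using n LIMSEQ_unique[OF _ orth_amplitude] by blast
    also have "\<dots> \<le> ?E * remainder a b n z"
    proof -
      have "remainder a b N z \<le> remainder a b N (of_real r)"
        using z by (intro remainder_mono) simp
      then show ?thesis
        using C M[OF z] remainder_nonneg[of n z]
        by (intro mult_right_mono mult_mono) (auto intro: mult_left_mono)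
    qed
    finally have le: "norm ((?p, ?q) - amplitude ?F n) \<le> ?E * remainder a b n z" .
    have "error n z = - ((?p - fst (amplitude ?F n)) * cnj (wave n)
        + (?q - snd (amplitude ?F n)) * wave n)"
      unfolding error_def scaled_amplitude(1)[OF N[OF n]] by (simp add: algebra_simps)
    then have "cmod (error n z) \<le> cmod (?p - fst (amplitude ?F n)) + cmod (?q - snd (amplitude ?F n))"
      using norm_triangle_ineq[of "(?p - fst (amplitude ?F n)) * cnj (wave n)"
          "(?q - snd (amplitude ?F n)) * wave n"]
      by (simp only: norm_minus_cancel norm_mult complex_mod_cnj norm_wave mult_1_right)
    also have "\<dots> \<le> 2 * norm ((?p, ?q) - amplitude ?F n)"
      using norm_fst_le[of "?p - fst (amplitude ?F n)" "?q - snd (amplitude ?F n)"]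
        norm_snd_le[of "?q - snd (amplitude ?F n)" "?p - fst (amplitude ?F n)"]
      by (cases "amplitude ?F n") simp
    finally show ?thesis using le by linarith
  qed
  then show ?thesis
    by (intro exI[of _ "2 * ?E"]) (auto simp: eventually_sequentially intro!: exI[of _ N])
qed

end

theorem theorem4p4:
  fixes a b :: "nat \<Rightarrow> real" and beta_inf :: real and eta :: "complex \<Rightarrow> real"
  assumes a_pos: "\<And>n. a n > 0"
    and a_inv: "summable (\<lambda>n. 1 / a n)"
    and beta_lim: "jbeta a b \<longlonglongrightarrow> beta_inf"
    and beta_inf: "\<bar>beta_inf\<bar> < 1"
    and k_sum: "summable (\<lambda>n. \<bar>jk a n - 1\<bar>)"
    and beta_sum: "summable (\<lambda>n. \<bar>jbeta a b (n + 1) - jbeta a b n\<bar>)"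
    and eta: "\<And>z. k_plus a b z = of_real (kappa a b z) * exp (\<i> * of_real (eta z))"
  shows "\<exists>R :: nat \<Rightarrow> complex \<Rightarrow> complex.
    (\<forall>n z. orth_poly a b n z = of_real (a n powr (- 1 / 2)) *
       (of_real (kappa a b z) * exp (- \<i> * of_real (phase a b n) + \<i> * of_real (eta z))
        + of_real (kappa a b (cnj z)) * exp (\<i> * of_real (phase a b n) - \<i> * of_real (eta (cnj z)))
        + R n z)) \<and>
    (\<forall>z. (\<lambda>n. R n z) \<in> O(\<lambda>n. of_real (remainder a b n z))) \<and>
    (\<forall>K. compact K \<longrightarrow>
       (\<exists>C. \<forall>\<^sub>F n in sequentially. \<forall>z\<in>K. cmod (R n z) \<le> C * remainder a b n z))"
proof -
  interpret convergent_jacobi a b beta_inf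
    by unfold_locales (fact a_pos a_inv beta_lim beta_inf k_sum beta_sum)+
  \<comment> \<open>One bound serves twice: compact sets are bounded, and a one-point set gives the
    order estimate for fixed \<open>z\<close>.\<close>
  have bound: "\<exists>C. \<forall>\<^sub>F n in sequentially. \<forall>z\<in>K. cmod (error n z) \<le> C * remainder a b n z"
    if "bounded K" for K
  proof -
    from that obtain r where r: "\<And>z. z \<in> K \<Longrightarrow> cmod z \<le> r"
      by (auto simp: bounded_iff)
    obtain C where "\<forall>\<^sub>F n in sequentially. \<forall>z. cmod z \<le> r \<longrightarrow> cmod (error n z) \<le> C * remainder a b n z"
      using error_bound by blast
    then have "\<forall>\<^sub>F n in sequentially. \<forall>z\<in>K. cmod (error n z) \<le> C * remainder a b n z"
      by eventually_elim (use r in blast)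
    then show ?thesis by blast
  qed
  have "orth_poly a b n z = of_real (a n powr (- 1 / 2)) *
       (of_real (kappa a b z) * exp (- \<i> * of_real (phase a b n) + \<i> * of_real (eta z))
        + of_real (kappa a b (cnj z)) * exp (\<i> * of_real (phase a b n) - \<i> * of_real (eta (cnj z)))
        + error n z)" for n z
  proof -
    have cnj_exp: "cnj (exp (\<i> * of_real x)) = exp (- (\<i> * of_real x))" for x
      using cis_cnj[of x] by (simp add: cis_conv_exp)
    have exps: "exp (\<i> * of_real (phase a b n)) = wave n"
      "exp (- \<i> * of_real (phase a b n)) = cnj (wave n)"
      by (simp_all add: wave_def cis_conv_exp cnj_exp)
    have 1: "of_real (kappa a b z) * exp (- \<i> * of_real (phase a b n) + \<i> * of_real (eta z))
        = k_plus a b z * cnj (wave n)"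
      unfolding exp_add exps eta[of z] by (simp add: mult_ac)
    \<comment> \<open>The polar form is taken at \<open>cnj z\<close>; conjugation then reverses the
      sign of its exponent.\<close>
    have "cnj (k_plus a b (cnj z)) = of_real (kappa a b (cnj z)) * exp (- (\<i> * of_real (eta (cnj z))))"
      by (subst eta) (simp add: cnj_exp)
    then have 2: "of_real (kappa a b (cnj z))
        * exp (\<i> * of_real (phase a b n) - \<i> * of_real (eta (cnj z)))
        = cnj (k_plus a b (cnj z)) * wave n"
      unfolding diff_conv_add_uminus exp_add exps by (simp add: mult_ac)
    have "sqrt (a n) \<noteq> 0" using a_pos[of n] by simp
    then show ?thesis
      unfolding 1 2 powr_minus_half by (simp add: error_def orth_poly_def scaled_def)
  qed
  moreover have "(\<lambda>n. error n z) \<in> O(\<lambda>n. of_real (remainder a b n z))" for z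
  proof -
    obtain C where "\<forall>\<^sub>F n in sequentially. \<forall>w\<in>{z}. cmod (error n w) \<le> C * remainder a b n w"
      using bound[of "{z}"] by auto
    then show ?thesis
      by (intro bigoI[of _ C]) (auto elim!: eventually_mono simp: remainder_nonneg)
  qed
  ultimately show ?thesis
    using bound compact_imp_bounded by (intro exI[of _ error]) blast
qed

end
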